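(* Let $a_1,a_2,a_3$ and $d\ge 2$ be integers. The number of monomials of degree $d$ in $S=\mathbb{C}[x_1,x_2,x_3]$ fixed by the action of $M_{a_1,a_2,a_3}$ is $$1+\frac{\gcd(a_2-a_1,a_3-a_1,d)\cdot d+\gcd(a_2-a_1,d)+\gcd(a_3-a_1,d)+\gcd(a_3-a_2,d)}{2}.$$
   Context: Let $\xi=e^{2\pi i/d}$. $M_{a_1,a_2,a_3}=\mathrm{diag}(\xi^{a_1},\xi^{a_2},\xi^{a_3})$ acts on $S$ by $x_i\mapsto\xi^{a_i}x_i$. Thus a monomial $x_1^{\alpha_1}x_2^{\alpha_2}x_3^{\alpha_3}$ is fixed iff $a_1\alpha_1+a_2\alpha_2+a_3\alpha_3\equiv 0 \pmod d$. Greatest common divisors are nonnegative, with $\gcd(0,d)=d$. *)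

theory Defs
  imports "HOL-Analysis.Analysis" "HOL-Library.Poly_Mapping"
begin

text \<open>Exponent vectors are finitely supported maps from the index type \<open>3\<close> of the variables, and
  \<open>\<complex>[x\<^sub>1, x\<^sub>2, x\<^sub>3]\<close> is the monoid algebra of the exponent vectors over \<^typ>\<open>complex\<close>. The type \<open>3\<close> has
  the elements \<open>1\<close>, \<open>2\<close> and \<open>3 = 0\<close>.\<close>

type_synonym mpoly3 = "(3 \<Rightarrow>\<^sub>0 nat) \<Rightarrow>\<^sub>0 complex"

definition Const :: "complex \<Rightarrow> mpoly3" where
  "Const c = Poly_Mapping.single 0 c"

definition Var :: "3 \<Rightarrow> mpoly3" where
  "Var i = Poly_Mapping.single (Poly_Mapping.single i 1) 1"

definition monomial :: "(3 \<Rightarrow>\<^sub>0 nat) \<Rightarrow> mpoly3" where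
  "monomial \<alpha> = (\<Prod>i\<in>UNIV. Var i ^ Poly_Mapping.lookup \<alpha> i)"

definition total_degree :: "(3 \<Rightarrow>\<^sub>0 nat) \<Rightarrow> nat" where
  "total_degree \<alpha> = (\<Sum>i\<in>UNIV. Poly_Mapping.lookup \<alpha> i)"

definition monomials_of_degree :: "nat \<Rightarrow> mpoly3 set" where
  "monomials_of_degree d = {monomial \<alpha> | \<alpha>. total_degree \<alpha> = d}"

text \<open>The endomorphism of the polynomial algebra that sends \<open>Var i\<close> to \<open>f i\<close>.\<close>

definition subst :: "(3 \<Rightarrow> mpoly3) \<Rightarrow> mpoly3 \<Rightarrow> mpoly3" where
  "subst f p = (\<Sum>\<alpha>\<in>Poly_Mapping.keys p. Const (Poly_Mapping.lookup p \<alpha>) * (\<Prod>i\<in>UNIV. f i ^ Poly_Mapping.lookup \<alpha> i))"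

text \<open>Only diagonal matrices are used, so acting by \<open>A\<close> or by its transpose makes no difference.\<close>

definition mat_act :: "complex^3^3 \<Rightarrow> mpoly3 \<Rightarrow> mpoly3" where
  "mat_act A = subst (\<lambda>i. \<Sum>j\<in>UNIV. Const (A $ i $ j) * Var j)"

definition xi :: "nat \<Rightarrow> complex" where
  "xi d = exp (2 * of_real pi * \<i> / of_nat d)"

definition diag :: "complex^3 \<Rightarrow> complex^3^3" where
  "diag v = (\<chi> i j. if i = j then v $ i else 0)"

definition M :: "nat \<Rightarrow> int \<Rightarrow> int \<Rightarrow> int \<Rightarrow> complex^3^3" where
  "M d a1 a2 a3 = diag (vector [xi d powi a1, xi d powi a2, xi d powi a3])"

lemma Const_0 [simp]: "Const 0 = 0"
  by (simp add: Const_def)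

lemma Const_1 [simp]: "Const 1 = 1"
  by (simp add: Const_def)

lemma monomial_eq_single: "monomial \<alpha> = Poly_Mapping.single \<alpha> 1"
proof -
  have pow: "Var i ^ n = Poly_Mapping.single (Poly_Mapping.single i n) 1" for i n
    by (induction n) (simp_all add: Var_def mult_single flip: single_add)
  have "(\<Prod>i\<in>I. Var i ^ Poly_Mapping.lookup \<alpha> i) =
      Poly_Mapping.single (\<Sum>i\<in>I. Poly_Mapping.single i (Poly_Mapping.lookup \<alpha> i)) 1" if "finite I" for I
    using that by (induction I rule: finite_induct) (simp_all add: pow mult_single)
  moreover have "(\<Sum>i\<in>UNIV. Poly_Mapping.single i (Poly_Mapping.lookup \<alpha> i)) = \<alpha>"
    by (rule poly_mapping_eqI) (simp add: lookup_sum lookup_single when_def)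
  ultimately show ?thesis
    by (simp add: monomial_def)
qed

lemma subst_monomial: "subst f (monomial \<alpha>) = (\<Prod>i\<in>UNIV. f i ^ Poly_Mapping.lookup \<alpha> i)"
  by (simp add: subst_def monomial_eq_single)

lemma subst_Var: "subst f (Var i) = f i"
proof -
  have "f j ^ Poly_Mapping.lookup (Poly_Mapping.single i 1) j = (if j = i then f i else 1)" for j
    by (simp add: lookup_single when_def)
  then show ?thesis
    by (simp add: subst_def Var_def)
qed

lemma mat_act_diag_Var: "mat_act (diag v) (Var i) = Const (v $ i) * Var i"
  by (simp add: mat_act_def subst_Var diag_def if_distrib [of Const] if_distrib [of "\<lambda>x. x * _"] cong: if_cong)

lemma mat_act_M_Var:
  "mat_act (M d a1 a2 a3) (Var 1) = Const (xi d powi a1) * Var 1"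
  "mat_act (M d a1 a2 a3) (Var 2) = Const (xi d powi a2) * Var 2"
  "mat_act (M d a1 a2 a3) (Var 3) = Const (xi d powi a3) * Var 3"
  by (simp_all add: M_def mat_act_diag_Var)

end

theory Submission
  imports Defs
begin

text \<open>In degree \<open>d\<close> the exponent of \<open>x\<^sub>1\<close> is determined by the other two, so the fixed monomials are
  the solutions of \<open>b y + c z \<equiv> 0 (mod d)\<close> in the triangle \<open>y, z \<ge> 0\<close>, \<open>y + z \<le> d\<close>, where
  \<open>b = a\<^sub>2 - a\<^sub>1\<close> and \<open>c = a\<^sub>3 - a\<^sub>1\<close>. The point reflection \<open>(y, z) \<mapsto> (d - y, d - z)\<close> maps this triangle
  to the complementary one in the square \<open>[0, d]\<^sup>2\<close> and preserves the congruence. Hence twice the number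
  of solutions in the triangle is the number in the square plus the number on the common diagonal
  \<open>y + z = d\<close>. In the half-open square there are \<open>d gcd(b, c, d)\<close> solutions, and the remaining edges
  and the diagonal contribute the other gcds.\<close>

section \<open>Linear congruences in one unknown\<close>

lemma card_multiples:
  fixes d e :: int
  assumes "d > 0" "e > 0" "e dvd d"
  shows "card {z \<in> {0..<d}. e dvd z} = nat (d div e)"
proof -
  obtain k where k: "d = e * k" using assms by blast
  have "bij_betw (\<lambda>i. e * i) {0..<k} {z \<in> {0..<d}. e dvd z}"
    by (rule bij_betwI [where g = "\<lambda>z. z div e"])
      (use assms k in \<open>auto simp: zero_le_mult_iff\<close>)
  then have "card {z \<in> {0..<d}. e dvd z} = card {0..<k}"
    by (metis bij_betw_same_card)
  then show ?thesis using assms k by simp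
qed

text \<open>After cancelling the gcd, \<open>m div gcd c m\<close> is coprime to the remaining
  factor of \<open>c\<close>.\<close>

lemma dvd_mult_iff_div_gcd_dvd:
  fixes c m z :: int
  assumes "m > 0"
  shows "m dvd c * z \<longleftrightarrow> m div gcd c m dvd z"
proof -
  let ?g = "gcd c m"
  have g: "?g > 0" using assms by simp
  have "m dvd c * z \<longleftrightarrow> ?g * (m div ?g) dvd ?g * (c div ?g * z)"
    by (simp flip: mult.assoc)
  also have "\<dots> \<longleftrightarrow> m div ?g dvd c div ?g * z"
    using g by (subst dvd_mult_cancel_left) auto
  also have "\<dots> \<longleftrightarrow> m div ?g dvd z"
    using div_gcd_coprime [of c m] assms
    by (simp add: coprime_dvd_mult_right_iff coprime_commute)
  finally show ?thesis .
qed

text \<open>The solutions are the multiples of \<open>m div gcd c m\<close>, which divides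
  \<open>d\<close>. The modulus \<open>m\<close> is kept apart from the range length
  \<open>d\<close> because the square count uses \<open>m = gcd b d\<close>.\<close>

lemma card_dvd_mult:
  fixes c d m :: int
  assumes "d > 0" "m > 0" "m dvd d"
  shows "int (card {z \<in> {0..<d}. m dvd c * z}) = d div m * gcd c m"
proof -
  let ?g = "gcd c m"
  have g: "?g > 0" "?g * (m div ?g) = m" using assms by auto
  then have pos: "m div ?g > 0"
    using assms by (metis zero_less_mult_pos)
  have "m div ?g dvd d"
    using g assms by (metis dvd_triv_right dvd_trans)
  moreover have "d div (m div ?g) = d div m * ?g"
  proof -
    obtain k where k: "d = m * k" using assms by blast
    have "d = k * ?g * (m div ?g)"
      using g k by (simp add: algebra_simps)
    then have "d div (m div ?g) = k * ?g"
      using pos by (metis nonzero_mult_div_cancel_right less_irrefl)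
    then show ?thesis using k assms by simp
  qed
  ultimately show ?thesis
    using card_multiples [of d "m div ?g"] pos assms g
    by (simp add: dvd_mult_iff_div_gcd_dvd pos_imp_zdiv_nonneg_iff)
qed

lemma card_dvd_mult_self:
  fixes b d :: int
  assumes "d > 0"
  shows "int (card {y \<in> {0..<d}. d dvd b * y}) = gcd b d"
  using card_dvd_mult [of d d b] assms by simp

lemma card_dvd_mult_self_atMost:
  fixes b d :: int
  assumes "d > 0"
  shows "int (card {y \<in> {0..d}. d dvd b * y}) = gcd b d + 1"
proof -
  \<comment> \<open>The end point \<open>y = d\<close> is always a solution.\<close>
  have "{y \<in> {0..d}. d dvd b * y} = insert d {y \<in> {0..<d}. d dvd b * y}"
    using assms by auto
  moreover have "card \<dots> = Suc (card {y \<in> {0..<d}. d dvd b * y})"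
    by (rule card_insert_disjoint) (simp_all del: atLeastLessThan_iff, simp)
  ultimately show ?thesis using card_dvd_mult_self [OF assms, of b] by simp
qed

text \<open>Modulo \<open>d\<close> the values \<open>b * y\<close> are exactly the multiples of
  \<open>gcd b d\<close>; if \<open>k\<close> is one of them, a shift makes the congruence
  homogeneous.\<close>

lemma card_dvd_affine:
  fixes b d k :: int
  assumes "d > 0"
  shows "int (card {y \<in> {0..<d}. d dvd b * y + k}) = (if gcd b d dvd k then gcd b d else 0)"
proof (cases "gcd b d dvd k")
  case True
  then obtain u v where "u * b + v * d = k"
    using bezout_int [of b d] by (metis dvd_def distrib_right mult.assoc mult.commute)
  then have k: "k = b * u + d * v" by (simp add: algebra_simps)
  \<comment> \<open>The summand \<open>d * v\<close> vanishes modulo \<open>d\<close>, so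
    \<open>k\<close> is absorbed by the shift \<open>u\<close>; reduction mod \<open>d\<close>
    returns to the interval.\<close>
  have shift: "d dvd b * y + k \<longleftrightarrow> d dvd b * ((y + u) mod d)" for y
  proof -
    have "d dvd b * y + k \<longleftrightarrow> d dvd b * (y + u) + d * v" by (simp add: k algebra_simps)
    also have "\<dots> \<longleftrightarrow> d dvd b * (y + u)" by (simp add: dvd_add_left_iff)
    also have "\<dots> \<longleftrightarrow> d dvd b * ((y + u) mod d)"
      by (simp add: dvd_eq_mod_eq_0 mod_mult_right_eq)
    finally show ?thesis .
  qed
  have "bij_betw (\<lambda>y. (y + u) mod d) {y \<in> {0..<d}. d dvd b * y + k} {y \<in> {0..<d}. d dvd b * y}"
  proof (rule bij_betwI [where g = "\<lambda>y. (y - u) mod d"])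
    show "(\<lambda>y. (y - u) mod d) \<in> {y \<in> {0..<d}. d dvd b * y} \<rightarrow> {y \<in> {0..<d}. d dvd b * y + k}"
      using assms by (auto simp: shift mod_simps)
  qed (use assms in \<open>auto simp: shift mod_simps\<close>)
  then show ?thesis
    using True card_dvd_mult_self [OF assms, of b] by (simp add: bij_betw_same_card)
next
  case False
  \<comment> \<open>\<open>gcd b d\<close> divides \<open>b * y\<close> and \<open>d\<close>, so a
    solution would force it to divide \<open>k\<close>.\<close>
  have "\<not> d dvd b * y + k" for y
    using False by (metis dvd_add_right_iff dvd_mult2 dvd_trans gcd_dvd1 gcd_dvd2)
  then show ?thesis using False by simp
qed

section \<open>Lattice points in the square and the triangle\<close>

lemma card_Collect_Times:
  assumes "finite A" "finite B"
  shows "card {(y, z). y \<in> A \<and> z \<in> B \<and> P y z} = (\<Sum>z\<in>B. card {y \<in> A. P y z})"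
proof -
  have "{(y, z). y \<in> A \<and> z \<in> B \<and> P y z} = prod.swap ` (SIGMA z:B. {y \<in> A. P y z})"
    by (auto simp: image_iff)
  then show ?thesis
    using assms by (simp add: card_image)
qed

text \<open>Fixing \<open>z\<close> leaves an affine congruence in \<open>y\<close>, solvable iff
  \<open>gcd b d\<close> divides \<open>c * z\<close>; summing over \<open>z\<close> is again a
  count in one unknown.\<close>

lemma card_dvd_square:
  fixes b c d :: int
  assumes "d > 0"
  shows "int (card {(y, z). y \<in> {0..d} \<and> z \<in> {0..d} \<and> d dvd b * y + c * z}) =
    d * gcd b (gcd c d) + gcd b d + gcd c d + 1"
proof -
  have row: "int (card {y \<in> {0..d}. d dvd b * y + c * z}) =
      (if gcd b d dvd c * z then gcd b d else 0) + (if d dvd c * z then 1 else 0)" for z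
  proof -
    have "{y \<in> {0..d}. d dvd b * y + c * z} =
        {y \<in> {0..<d}. d dvd b * y + c * z} \<union> (if d dvd c * z then {d} else {})"
      using assms by (auto simp: dvd_add_right_iff order_le_less)
    moreover have "card \<dots> = card {y \<in> {0..<d}. d dvd b * y + c * z} + card (if d dvd c * z then {d} else {})"
      by (rule card_Un_disjoint) (simp_all del: atLeastLessThan_iff, simp)
    ultimately show ?thesis using card_dvd_affine [OF assms, of b "c * z"] by simp
  qed
  have count: "(\<Sum>z\<in>{0..<d}. if P z then n else 0) = n * int (card {z \<in> {0..<d}. P z})" for P and n :: int
    by (simp flip: sum.inter_filter)
  have closed: "{0..d} = insert d {0..<d}" using assms by auto
  have "int (card {(y, z). y \<in> {0..d} \<and> z \<in> {0..d} \<and> d dvd b * y + c * z}) =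
      (\<Sum>z\<in>{0..d}. int (card {y \<in> {0..d}. d dvd b * y + c * z}))"
    by (subst card_Collect_Times) simp_all
  also have "\<dots> = (\<Sum>z\<in>{0..d}. (if gcd b d dvd c * z then gcd b d else 0) + (if d dvd c * z then 1 else 0))"
    by (simp only: row)
  \<comment> \<open>The row \<open>z = d\<close> satisfies both conditions.\<close>
  also have "\<dots> = gcd b d + 1 +
      (\<Sum>z\<in>{0..<d}. (if gcd b d dvd c * z then gcd b d else 0) + (if d dvd c * z then 1 else 0))"
    by (simp add: closed)
  \<comment> \<open>The first sum is a count with modulus \<open>gcd b d\<close>; the second is the
    edge \<open>y = d\<close> without its corner \<open>z = d\<close>.\<close>
  also have "(\<Sum>z\<in>{0..<d}. (if gcd b d dvd c * z then gcd b d else 0) + (if d dvd c * z then 1 else 0)) =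
      gcd b d * (d div gcd b d * gcd c (gcd b d)) + gcd c d"
    unfolding sum.distrib count
    using card_dvd_mult [of d "gcd b d" c] card_dvd_mult_self [of d c] assms by simp
  also have "gcd b d * (d div gcd b d * gcd c (gcd b d)) = d * gcd b (gcd c d)"
    by (simp add: gcd.left_commute flip: mult.assoc)
  finally show ?thesis by simp
qed

lemma card_dvd_triangle:
  fixes b c d :: int
  assumes "d > 0"
  shows "2 * int (card {(y, z). 0 \<le> y \<and> 0 \<le> z \<and> y + z \<le> d \<and> d dvd b * y + c * z}) =
    d * gcd b (gcd c d) + gcd b d + gcd c d + gcd (c - b) d + 2"
proof -
  define S where "S = {(y, z). y \<in> {0..d} \<and> z \<in> {0..d} \<and> d dvd b * y + c * z}"
  define L where "L = {(y, z). (y, z) \<in> S \<and> y + z \<le> d}"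
  define U where "U = {(y, z). (y, z) \<in> S \<and> y + z \<ge> d}"
  have "S \<subseteq> {0..d} \<times> {0..d}" by (auto simp: S_def)
  then have "finite S" by (rule finite_subset) auto
  then have fin: "finite L" "finite U"
    by (auto simp: L_def U_def elim: finite_subset [rotated])
  \<comment> \<open>The two linear forms add up to \<open>d * (b + c)\<close>.\<close>
  have reflect: "d dvd b * (d - y) + c * (d - z) \<longleftrightarrow> d dvd b * y + c * z" for y z
  proof -
    have "b * (d - y) + c * (d - z) = d * (b + c) - (b * y + c * z)" by (simp add: algebra_simps)
    then show ?thesis by (metis dvd_diff_right_iff dvd_triv_left)
  qed
  have "bij_betw (\<lambda>(y, z). (d - y, d - z)) L U"
    by (rule bij_betwI [where g = "\<lambda>(y, z). (d - y, d - z)"])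
      (auto simp: L_def U_def S_def reflect)
  then have "card L = card U" by (rule bij_betw_same_card)
  moreover have "L \<union> U = S" by (auto simp: L_def U_def)
  \<comment> \<open>Parametrising the diagonal by \<open>y\<close> gives a congruence in
    \<open>(c - b) * y\<close> on the closed interval, whose right end point yields the
    \<open>+ 1\<close>.\<close>
  moreover have "int (card (L \<inter> U)) = gcd (c - b) d + 1"
  proof -
    have diag: "d dvd b * y + c * (d - y) \<longleftrightarrow> d dvd (c - b) * y" for y
    proof -
      have "b * y + c * (d - y) = d * c - (c - b) * y" by (simp add: algebra_simps)
      then show ?thesis by (metis dvd_diff_right_iff dvd_triv_left)
    qed
    have "bij_betw (\<lambda>y. (y, d - y)) {y \<in> {0..d}. d dvd (c - b) * y} (L \<inter> U)"
      by (rule bij_betwI [where g = fst]) (auto simp: L_def U_def S_def simp flip: diag)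
    then show ?thesis
      using card_dvd_mult_self_atMost [OF assms, of "c - b"] by (simp add: bij_betw_same_card)
  qed
  moreover have "L = {(y, z). 0 \<le> y \<and> 0 \<le> z \<and> y + z \<le> d \<and> d dvd b * y + c * z}"
    by (auto simp: L_def S_def)
  ultimately show ?thesis
    using card_Un_Int [OF fin] card_dvd_square [OF assms, of b c] by (simp add: S_def)
qed

section \<open>The action on monomials\<close>

lemma xi_nonzero [simp]: "xi d \<noteq> 0"
  by (simp add: xi_def)

text \<open>\<open>exp\<close> takes the value 1 exactly at the integer multiples of
  \<open>2 * pi * \<i>\<close>, so \<open>xi d\<close> is a primitive root of unity of order
  \<open>d\<close>.\<close>

lemma xi_powi_eq_1_iff:
  assumes "d > 0"
  shows "xi d powi n = 1 \<longleftrightarrow> int d dvd n"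
proof -
  have "xi d powi n = exp (of_int n * (2 * of_real pi * \<i> / of_nat d))"
    by (simp add: xi_def exp_power_int)
  also have "\<dots> = 1 \<longleftrightarrow> (\<exists>k::int. 2 * pi * n / d = of_int (2 * k) * pi)"
    by (simp add: exp_eq_1 algebra_simps)
  also have "\<dots> \<longleftrightarrow> (\<exists>k::int. real_of_int n = real_of_int (int d * k))"
    using assms by (intro ex_cong1) (simp add: field_simps)
  also have "\<dots> \<longleftrightarrow> int d dvd n"
    by (simp only: of_int_eq_iff dvd_def)
  finally show ?thesis .
qed

lemma Const_mult: "Const (x * y) = Const x * Const y"
  by (simp add: Const_def mult_single)

lemma Const_power: "Const (x ^ n) = Const x ^ n"
  by (induction n) (simp_all add: Const_mult)

text \<open>Substitution is multiplicative on monomials and scales each variable, so monomials are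
  eigenvectors.\<close>

lemma mat_act_diag_monomial:
  "mat_act (diag v) (monomial \<alpha>) = Const (\<Prod>i\<in>UNIV. v $ i ^ Poly_Mapping.lookup \<alpha> i) * monomial \<alpha>"
proof -
  have "Const (\<Prod>i\<in>I. f i) = (\<Prod>i\<in>I. Const (f i))" if "finite I" for I :: "3 set" and f
    using that by (induction I rule: finite_induct) (simp_all add: Const_mult)
  moreover have "mat_act (diag v) (monomial \<alpha>) =
      (\<Prod>i\<in>UNIV. (mat_act (diag v) (Var i)) ^ Poly_Mapping.lookup \<alpha> i)"
    by (simp add: mat_act_def subst_monomial subst_Var)
  ultimately show ?thesis
    by (simp add: mat_act_diag_Var monomial_def Const_power power_mult_distrib prod.distrib)
qed

lemma inj_monomial: "inj monomial"
  by (rule injI) (metis monomial_eq_single lookup_single_eq lookup_single_not_eq zero_neq_one)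

text \<open>The eigenvalue is \<open>xi d\<close> to the weighted degree; comparing coefficients at
  \<alpha>, the monomial is fixed iff this power is 1.\<close>

lemma mat_act_M_monomial_eq_iff:
  assumes "d > 0"
  shows "mat_act (M d a1 a2 a3) (monomial \<alpha>) = monomial \<alpha> \<longleftrightarrow>
    int d dvd a1 * int (Poly_Mapping.lookup \<alpha> 1) + a2 * int (Poly_Mapping.lookup \<alpha> 2)
      + a3 * int (Poly_Mapping.lookup \<alpha> 3)" (is "_ \<longleftrightarrow> int d dvd ?s")
proof -
  have "xi d powi ?s = (xi d powi a1) ^ Poly_Mapping.lookup \<alpha> 1
      * (xi d powi a2) ^ Poly_Mapping.lookup \<alpha> 2 * (xi d powi a3) ^ Poly_Mapping.lookup \<alpha> 3"
    by (simp only: power_int_add power_int_mult power_int_of_nat xi_nonzero simp_thms)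
  then have "mat_act (M d a1 a2 a3) (monomial \<alpha>) = Const (xi d powi ?s) * monomial \<alpha>"
    unfolding M_def mat_act_diag_monomial by (simp only: UNIV_3) (simp add: mult.assoc)
  then have "mat_act (M d a1 a2 a3) (monomial \<alpha>) = Poly_Mapping.single \<alpha> (xi d powi ?s)"
    by (simp add: Const_def monomial_eq_single mult_single)
  then have "mat_act (M d a1 a2 a3) (monomial \<alpha>) = monomial \<alpha> \<longleftrightarrow> xi d powi ?s = 1"
    by (metis monomial_eq_single lookup_single_eq)
  then show ?thesis by (simp add: xi_powi_eq_1_iff [OF assms])
qed

text \<open>The last two exponents serve as integer coordinates, matching the lattice point count;
  \<open>y + z \<le> int d\<close> makes the subtraction of naturals exact.\<close>

lemma bij_betw_fixed_monomials:
  fixes a1 a2 a3 :: int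
  assumes "d > 0"
  shows "bij_betw (\<lambda>(y, z). monomial (Poly_Mapping.single 1 (d - nat y - nat z)
        + Poly_Mapping.single 2 (nat y) + Poly_Mapping.single 3 (nat z)))
    {(y, z). 0 \<le> y \<and> 0 \<le> z \<and> y + z \<le> int d \<and> int d dvd (a2 - a1) * y + (a3 - a1) * z}
    {m \<in> monomials_of_degree d. mat_act (M d a1 a2 a3) m = m}"
    (is "bij_betw (\<lambda>(y, z). monomial (?h y z)) ?T ?F")
proof -
  have lookup: "Poly_Mapping.lookup (?h y z) 1 = d - nat y - nat z"
    "Poly_Mapping.lookup (?h y z) 2 = nat y" "Poly_Mapping.lookup (?h y z) 3 = nat z" for y z
    by (simp_all add: lookup_add lookup_single when_def)
  have inj: "inj_on (\<lambda>(y, z). monomial (?h y z)) ?T"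
  proof (rule inj_onI, clarify)
    fix y z y' z'
    assume nonneg: "0 \<le> y" "0 \<le> z" "0 \<le> y'" "0 \<le> z'" and "monomial (?h y z) = monomial (?h y' z')"
    then have "?h y z = ?h y' z'" using inj_monomial by (simp add: inj_eq)
    then have "nat y = nat y'" "nat z = nat z'" by (metis lookup(2), metis lookup(3))
    then show "y = y' \<and> z = z'" using nonneg by (metis eq_nat_nat_iff)
  qed
  \<comment> \<open>The weighted degree exceeds the form in \<open>y\<close> and \<open>z\<close> by
    \<open>int d * a1\<close>.\<close>
  have weight: "int d dvd a1 * (int d - y - z) + a2 * y + a3 * z \<longleftrightarrow>
      int d dvd (a2 - a1) * y + (a3 - a1) * z" for y z
  proof -
    have "a1 * (int d - y - z) + a2 * y + a3 * z = int d * a1 + ((a2 - a1) * y + (a3 - a1) * z)"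
      by (simp add: algebra_simps)
    then show ?thesis by (metis dvd_add_right_iff dvd_triv_left)
  qed
  have "(\<lambda>(y, z). monomial (?h y z)) ` ?T = ?F"
  proof (intro equalityI subsetI)
    fix m assume "m \<in> (\<lambda>(y, z). monomial (?h y z)) ` ?T"
    then obtain y z where m: "m = monomial (?h y z)" and yz: "0 \<le> y" "0 \<le> z" "y + z \<le> int d"
      and dvd: "int d dvd (a2 - a1) * y + (a3 - a1) * z" by auto
    have "total_degree (?h y z) = d"
      using yz unfolding total_degree_def sum_3 lookup by linarith
    moreover have x: "int (d - nat y - nat z) = int d - y - z" using yz by linarith
    have "mat_act (M d a1 a2 a3) m = m"
      unfolding m mat_act_M_monomial_eq_iff [OF assms] lookup x
      using dvd weight [of y z] yz by (simp only: nat_0_le)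
    ultimately show "m \<in> ?F" by (auto simp: monomials_of_degree_def m)
  next
    fix m assume "m \<in> ?F"
    then obtain \<alpha> where m: "m = monomial \<alpha>" and deg: "total_degree \<alpha> = d"
      and fix_m: "mat_act (M d a1 a2 a3) m = m" by (auto simp: monomials_of_degree_def)
    \<comment> \<open>These coordinates give the preimage; the degree recovers the first
      exponent.\<close>
    define y z where "y = int (Poly_Mapping.lookup \<alpha> 2)" and "z = int (Poly_Mapping.lookup \<alpha> 3)"
    have x: "int (Poly_Mapping.lookup \<alpha> 1) = int d - y - z"
      using deg by (simp add: total_degree_def sum_3 y_def z_def flip: of_nat_add)
    have exps: "Poly_Mapping.lookup \<alpha> 1 = d - nat y - nat z"
      "Poly_Mapping.lookup \<alpha> 2 = nat y" "Poly_Mapping.lookup \<alpha> 3 = nat z"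
      using x by (simp_all add: y_def z_def)
    have "\<alpha> = ?h y z"
    proof (rule poly_mapping_eqI)
      fix i :: 3
      show "Poly_Mapping.lookup \<alpha> i = Poly_Mapping.lookup (?h y z) i"
        using exhaust_3 [of i] by (elim disjE) (simp_all only: exps lookup)
    qed
    moreover have "(y, z) \<in> ?T"
      using fix_m x weight [of y z] unfolding m mat_act_M_monomial_eq_iff [OF assms]
      by (simp add: y_def z_def)
    ultimately show "m \<in> (\<lambda>(y, z). monomial (?h y z)) ` ?T"
      unfolding m by (intro image_eqI [where x = "(y, z)"]) auto
  qed
  with inj show ?thesis by (simp add: bij_betw_def)
qed

theorem proposition7p2:
  fixes a1 a2 a3 :: int and d :: nat
  assumes "d \<ge> 2"
  shows "real (card {m \<in> monomials_of_degree d. mat_act (M d a1 a2 a3) m = m}) =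
    1 + real_of_int (gcd (a2 - a1) (gcd (a3 - a1) (int d)) * int d
          + gcd (a2 - a1) (int d) + gcd (a3 - a1) (int d) + gcd (a3 - a2) (int d)) / 2"
proof -
  have d: "d > 0" using assms by simp
  let ?N = "card {m \<in> monomials_of_degree d. mat_act (M d a1 a2 a3) m = m}"
  \<comment> \<open>Doubling avoids integer division, and
    \<open>(a3 - a1) - (a2 - a1) = a3 - a2\<close> gives the last gcd.\<close>
  have "2 * int ?N = int d * gcd (a2 - a1) (gcd (a3 - a1) (int d)) + gcd (a2 - a1) (int d)
      + gcd (a3 - a1) (int d) + gcd (a3 - a2) (int d) + 2"
    using card_dvd_triangle [of "int d" "a2 - a1" "a3 - a1"] d
    by (simp flip: bij_betw_same_card [OF bij_betw_fixed_monomials [OF d]])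
  then have "2 * real ?N = real_of_int (gcd (a2 - a1) (gcd (a3 - a1) (int d)) * int d
      + gcd (a2 - a1) (int d) + gcd (a3 - a1) (int d) + gcd (a3 - a2) (int d)) + 2"
    by (metis (no_types, lifting) mult.commute of_int_add of_int_mult of_int_numeral of_int_of_nat_eq)
  then show ?thesis by (simp add: field_simps)
qed

end
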